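(* Consider the problem of minimizing $f=\sum_{i=1}^m f_i$ over $X$, and suppose that Assumption 1 (common optimal solution) and Assumption 2 (Hölder condition of order $p>0$ with moduli $L_i$) stated in the context hold. Let $\{x_k\}$ be a sequence generated by the incremental subgradient method described in the context with the dynamic stepsize rule $$v_k=\gamma_k\frac{C_{p,m}}{m^2}\left(f(x_k)-f^*\right)^{\frac1p}\quad\text{for any }k\in\mathbb{N},$$ where $0<\underline{\gamma}\le\gamma_k\le\overline{\gamma}<2$ and $C_{p,m}:=L_{\max}^{-\frac1p}\min\{1,(2m)^{1-\frac1p}\}$. Then $\{x_k\}$ converges to an optimal solution of the problem, i.e. to a point of $X^*$.
   Context: Setting. $X\subseteq\mathbb{R}^n$ is nonempty, closed and convex, and $f_1,\dots,f_m:\mathbb{R}^n\to\mathbb{R}$ are continuous and quasi-convex (a function $h$ is quasi-convex if $h((1-\alpha)x+\alpha y)\le\max\{h(x),h(y)\}$ for all $x,y\in\mathbb{R}^n$, $\alpha\in[0,1]$). Put $f:=\sum_{i=1}^m f_i$ ($f$ need not be quasi-convex), $f^*:=\min_{x\in X}f(x)$, $X^*:=\arg\min_{x\in X}f(x)$, $f_i^*:=\min_{x\in X}f_i(x)$, $X_i^*:=\arg\min_{x\in X}f_i(x)$. $\mathbb{N}=\{0,1,2,\dots\}$; $\|\cdot\|$ is the Euclidean norm, $P_X$ the Euclidean projection onto $X$, and $S(0,1)$ the unit sphere. $\underline\gamma,\overline\gamma$ are constants. Assumption 1. The component functions have a common optimal solution over $X$ (equivalently $X^*=\bigcap_{i=1}^m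 X_i^*\neq\emptyset$). Assumption 2. $p>0$, $L_i>0$ for $i=1,\dots,m$, and for each $i$, $|f_i(y)-f_i(x)|\le L_i\|y-x\|^p$ for all $x\in X$ and all $y\in\mathbb{R}^n$. Put $L_{\max}:=\max_{i=1,\dots,m}L_i$. Quasi-subdifferential. For quasi-convex $h:\mathbb{R}^n\to\mathbb{R}$ and $x\in\mathbb{R}^n$, $\partial h(x):=\{g:\langle g,y-x\rangle\le 0\text{ for every } y \text{ with } h(y)<h(x)\}$. Incremental subgradient method. Initialize an initial point $x_0\in\mathbb{R}^n$, a stepsize sequence $\{v_k\}$, and $k:=0$. While $f(x_k)>f^*$: set $z_{k,0}:=x_k$; for $i=1,\dots,m$: if $f_i(z_{k,i-1})=f_i^*$, set $z_{k,i}:=z_{k,i-1}$; otherwise calculate $g_{k,i}\in\partial f_i(z_{k,i-1})\cap S(0,1)$ and set $z_{k,i}:=P_X(z_{k,i-1}-v_kg_{k,i})$. Then set $x_{k+1}:=z_{k,m}$ and $k:=k+1$.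
   Formalization: The formal theorem also assumes that x_0 lies in X or f(x_0) > f^*; otherwise the method stops at once at an infeasible point and the claim fails (e.g. X=[1,2], m=1, f(x)=|x|, x_0=-1). *)

theory Defs
  imports "HOL-Analysis.Analysis"
begin

definition quasi_convex :: "('a::real_vector \<Rightarrow> real) \<Rightarrow> bool" where
  "quasi_convex h \<longleftrightarrow>
     (\<forall>x y \<alpha>. 0 \<le> \<alpha> \<and> \<alpha> \<le> 1 \<longrightarrow> h ((1 - \<alpha>) *\<^sub>R x + \<alpha> *\<^sub>R y) \<le> max (h x) (h y))"

definition quasi_subdiff :: "('a::real_inner \<Rightarrow> real) \<Rightarrow> 'a \<Rightarrow> 'a set" where
  "quasi_subdiff h x = {g. \<forall>y. h y < h x \<longrightarrow> g \<bullet> (y - x) \<le> 0}"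

definition argmin_set :: "'a set \<Rightarrow> ('a \<Rightarrow> real) \<Rightarrow> 'a set" where
  "argmin_set X h = {x. is_arg_min h (\<lambda>x. x \<in> X) x}"

(* The minimum of h over X; meaningful only if it is attained, i.e. if argmin_set X h is nonempty. *)
definition min_value :: "'a set \<Rightarrow> ('a \<Rightarrow> real) \<Rightarrow> real" where
  "min_value X h = (LEAST v. v \<in> h ` X)"

definition objective :: "nat \<Rightarrow> (nat \<Rightarrow> 'a \<Rightarrow> real) \<Rightarrow> 'a \<Rightarrow> real" where
  "objective m f x = (\<Sum>i = 1..m. f i x)"

(* One pass through the components f 1, ..., f m with stepsize v, leading from x to x'.
   It is a relation because each subgradient may be chosen freely. *)
definition incremental_pass ::
  "'a::euclidean_space set \<Rightarrow> nat \<Rightarrow> (nat \<Rightarrow> 'a \<Rightarrow> real) \<Rightarrow> real \<Rightarrow> 'a \<Rightarrow> 'a \<Rightarrow> bool" where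
  "incremental_pass X m f v x x' \<longleftrightarrow>
     (\<exists>z. z 0 = x \<and> z m = x' \<and>
        (\<forall>i\<in>{1..m}.
           if f i (z (i - 1)) = min_value X (f i)
           then z i = z (i - 1)
           else \<exists>g \<in> quasi_subdiff (f i) (z (i - 1)) \<inter> sphere 0 1.
                  z i = closest_point X (z (i - 1) - v *\<^sub>R g)))"

(* A run that leaves the while loop at step k is continued by the constant sequence x k, so that
   infinite and terminating runs are both represented by sequences indexed by the naturals. *)
definition generated_by_incremental_method ::
  "'a::euclidean_space set \<Rightarrow> nat \<Rightarrow> (nat \<Rightarrow> 'a \<Rightarrow> real) \<Rightarrow> (nat \<Rightarrow> real) \<Rightarrow> (nat \<Rightarrow> 'a) \<Rightarrow> bool" where
  "generated_by_incremental_method X m f v x \<longleftrightarrow>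
     (\<forall>k. if objective m f (x k) > min_value X (objective m f)
          then incremental_pass X m f (v k) (x k) (x (Suc k))
          else x (Suc k) = x k)"

definition step_const :: "real \<Rightarrow> nat \<Rightarrow> (nat \<Rightarrow> real) \<Rightarrow> real" where
  "step_const p m L =
     Max (L ` {1..m}) powr (- (1 / p)) * min 1 (real (2 * m) powr (1 - 1 / p))"

end

theory Submission
  imports Defs
begin

text \<open>
  Fix a common minimizer \<open>s\<close> of the components. The unit vector \<open>g\<close> is normal to a half-space that
  contains the sublevel set \<open>{y. h y < h z}\<close>. By the Hoelder condition this sublevel set contains every
  ball around \<open>s\<close> of radius less than \<open>((h z - h s) / K) powr (1 / p)\<close>, so \<open>s\<close> has at least this depth
  in the half-space: \<open>g \<bullet> (z - s) \<ge> ((h z - h s) / K) powr (1 / p)\<close> (lemma \<open>quasi_subdiff_gap\<close>).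
  Projected steps against \<open>g\<close> therefore approach \<open>s\<close>: if \<open>r i\<close> is the depth met by the \<open>i\<close>-th
  inner step, a pass with stepsize \<open>v\<close> changes the squared distance to \<open>s\<close> by at most
  \<open>- 2 v (\<Sum>i. r i) + m v\<^sup>2\<close>.

  The depths are measured at the inner iterates, whereas the stepsize depends on the gap
  \<open>D = f x - f s\<close> at the start of the pass. The inner iterate used by component \<open>i\<close> is within \<open>(i - 1) v\<close>
  of \<open>x\<close>, so the Hoelder condition bounds \<open>D / K\<close> by the sum of the \<open>p\<close>-th powers of the \<open>2 m\<close>
  numbers \<open>r i\<close> and \<open>(i - 1) v\<close>. Comparing this sum with the \<open>p\<close>-th power of the plain sum (lemma
  \<open>sum_ge_powr_inverse\<close>) costs the factor \<open>min 1 ((2 m) powr (1 - 1 / p))\<close> and gives, with \<open>C\<close> the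
  constant of the stepsize rule,
  \<open>(\<Sum>i. r i) \<ge> C * D powr (1 / p) - v m (m - 1) / 2\<close>.
  Hence the squared distance to \<open>s\<close> changes by at most \<open>- 2 v C * D powr (1 / p) + m\<^sup>2 v\<^sup>2\<close> (lemma
  \<open>incremental_pass_descent\<close>). The dynamic stepsize is \<open>\<gamma>\<close> times the minimizer of this quadratic in \<open>v\<close>,
  which turns the bound into \<open>- \<gamma> (2 - \<gamma>) (C / m)\<^sup>2 * D powr (2 / p)\<close>.

  Since \<open>\<gamma>\<close> stays away from \<open>0\<close> and \<open>2\<close>, summing over the passes shows that the gaps tend to \<open>0\<close>,
  and that the distance to every optimal point is nonincreasing, as all of these are common
  minimizers (lemma \<open>argmin_objective\<close>). The iterates are thus bounded, their
  cluster points are optimal by continuity, and monotonicity of the distance to such a cluster point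
  forces the whole sequence to converge to it (lemma \<open>fejer_monotone_convergent\<close>).

  An initial point outside \<open>X\<close> is harmless: a pass that starts there with a value above the
  minimum projects at least once, so all later iterates lie in \<open>X\<close>.
\<close>

section \<open>Minimizers of a sum with a common minimizer\<close>

lemma min_value_eq:
  assumes "s \<in> argmin_set X h"
  shows "min_value X h = h s"
  unfolding min_value_def
  using assms by (intro Least_equality) (auto simp: argmin_set_def is_arg_min_def not_less)

lemma argmin_set_iff:
  "s \<in> argmin_set X h \<longleftrightarrow> s \<in> X \<and> (\<forall>y\<in>X. h s \<le> h y)"
  by (auto simp: argmin_set_def is_arg_min_def not_less)

text \<open>
  A minimizer \<open>s\<close> of the sum that failed to minimize one summand would be beaten by the common
  minimizer \<open>c\<close>, which is no worse in the other summands.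
\<close>
lemma argmin_objective:
  assumes "(\<Inter>i\<in>{1..m}. argmin_set X (f i)) \<noteq> {}" and "m \<ge> 1"
  shows "argmin_set X (objective m f) = (\<Inter>i\<in>{1..m}. argmin_set X (f i))"
proof -
  obtain c where c: "\<And>i. i \<in> {1..m} \<Longrightarrow> c \<in> argmin_set X (f i)"
    using assms(1) by blast
  then have "c \<in> X"
    using \<open>m \<ge> 1\<close> by (force simp: argmin_set_iff)
  have "f i s \<le> f i y" if s: "s \<in> argmin_set X (objective m f)" and i: "i \<in> {1..m}" and "y \<in> X" for s i y
  proof (rule ccontr)
    assume "\<not> f i s \<le> f i y"
    then have "f i c < f i s"
      using c[OF i] \<open>y \<in> X\<close> by (force simp: argmin_set_iff)
    moreover have "\<forall>j\<in>{1..m}. f j c \<le> f j s"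
      using c s by (auto simp: argmin_set_iff)
    ultimately have "objective m f c < objective m f s"
      unfolding objective_def using i by (intro sum_strict_mono_ex1) auto
    with s \<open>c \<in> X\<close> show False
      by (auto simp: argmin_set_iff not_less[symmetric])
  qed
  then show ?thesis
    using \<open>m \<ge> 1\<close> by (force simp: argmin_set_iff objective_def intro!: sum_mono)
qed

section \<open>Powers of sums\<close>

text \<open>
  For \<open>q \<ge> 1\<close> this is Jensen's inequality for the convex function \<open>t powr q\<close>; for \<open>q \<le> 1\<close> it is the
  subadditivity of \<open>t powr q\<close>. The minimum is the factor \<open>card A powr (1 - q)\<close> in the first case and
  \<open>1\<close> in the second.
\<close>
lemma powr_sum_le_sum_powr:
  fixes b :: "'i \<Rightarrow> real"
  assumes "finite A" and b: "\<And>j. j \<in> A \<Longrightarrow> 0 \<le> b j" and "q > 0"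
  shows "min 1 (real (card A) powr (1 - q)) * (\<Sum>j\<in>A. b j) powr q \<le> (\<Sum>j\<in>A. b j powr q)"
proof (cases "(\<Sum>j\<in>A. b j) = 0")
  case True
  then show ?thesis by (simp add: sum_nonneg)
next
  case False
  \<comment> \<open>Vanishing terms are dropped because convexity of \<open>powr\<close> is used on the open half-line.\<close>
  define B where "B = {j\<in>A. b j > 0}"
  define S where "S = (\<Sum>j\<in>B. b j)"
  have "B \<subseteq> A" "finite B"
    using \<open>finite A\<close> by (auto simp: B_def)
  have S: "(\<Sum>j\<in>A. b j) = S" "(\<Sum>j\<in>A. b j powr q) = (\<Sum>j\<in>B. b j powr q)"
    unfolding S_def using \<open>finite A\<close> b
    by (auto intro!: sum.mono_neutral_right simp: B_def) (force simp: B_def)+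
  have "S > 0"
    using False b S sum_nonneg[of A b] by force
  then have "B \<noteq> {}"
    by (auto simp: S_def)
  then have n: "real (card B) > 0"
    using \<open>finite B\<close> by (simp add: card_gt_0_iff)
  have "min 1 (real (card A) powr (1 - q)) * S powr q \<le> (\<Sum>j\<in>B. b j powr q)"
  proof (cases "q \<ge> 1")
    case True
    have "((\<Sum>j\<in>B. (1 / real (card B)) *\<^sub>R b j)) powr q \<le> (\<Sum>j\<in>B. (1 / real (card B)) * b j powr q)"
      using n \<open>B \<noteq> {}\<close> \<open>finite B\<close>
      by (intro convex_on_sum[OF _ _ powr_convex[OF True]]) (auto simp: B_def)
    then have "(S / real (card B)) powr q \<le> (\<Sum>j\<in>B. b j powr q) / real (card B)"
      by (simp add: S_def sum_divide_distrib)
    then have "real (card B) powr (1 - q) * S powr q \<le> (\<Sum>j\<in>B. b j powr q)"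
      using n by (simp add: powr_diff powr_divide field_simps)
    moreover have "real (card A) powr (1 - q) \<le> real (card B) powr (1 - q)"
      using True n card_mono[OF \<open>finite A\<close> \<open>B \<subseteq> A\<close>] by (intro powr_mono2') auto
    ultimately show ?thesis
      by (smt (verit) mult_right_mono powr_ge_zero)
  next
    case False
    \<comment> \<open>Each share \<open>b j / S\<close> lies in \<open>[0, 1]\<close>, hence is at most its own \<open>q\<close>-th power.\<close>
    have "b j / S * S powr q \<le> b j powr q" if "j \<in> B" for j
    proof -
      have "b j \<le> S" "b j > 0"
        unfolding S_def using that \<open>finite B\<close> by (auto intro!: member_le_sum simp: B_def)
      then have "(b j / S) powr 1 \<le> (b j / S) powr q"
        using False \<open>S > 0\<close> by (intro powr_mono') auto
      then have "b j / S \<le> b j powr q / S powr q"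
        using \<open>b j > 0\<close> \<open>S > 0\<close> by (simp add: powr_divide)
      then show ?thesis
        using \<open>S > 0\<close> by (simp add: field_simps)
    qed
    then have "(\<Sum>j\<in>B. b j / S * S powr q) \<le> (\<Sum>j\<in>B. b j powr q)"
      by (rule sum_mono)
    moreover have "(\<Sum>j\<in>B. b j / S * S powr q) = S powr q"
      using \<open>S > 0\<close> by (simp add: S_def flip: sum_distrib_right sum_divide_distrib)
    ultimately show ?thesis
      using mult_right_mono[of "min 1 (real (card A) powr (1 - q))" 1 "S powr q"] by simp
  qed
  then show ?thesis
    by (simp add: S)
qed

lemma sum_ge_powr_inverse:
  fixes a :: "'i \<Rightarrow> real"
  assumes "finite A" and a: "\<And>j. j \<in> A \<Longrightarrow> 0 \<le> a j" and "p > 0"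
    and D: "0 \<le> D" "D \<le> (\<Sum>j\<in>A. a j powr p)"
  shows "min 1 (real (card A) powr (1 - 1 / p)) * D powr (1 / p) \<le> (\<Sum>j\<in>A. a j)"
proof -
  have "min 1 (real (card A) powr (1 - 1 / p)) * D powr (1 / p)
      \<le> min 1 (real (card A) powr (1 - 1 / p)) * (\<Sum>j\<in>A. a j powr p) powr (1 / p)"
    using D \<open>p > 0\<close> by (intro mult_left_mono powr_mono2) auto
  also have "\<dots> \<le> (\<Sum>j\<in>A. (a j powr p) powr (1 / p))"
    using assms by (intro powr_sum_le_sum_powr) auto
  also have "\<dots> = (\<Sum>j\<in>A. a j)"
    using a \<open>p > 0\<close> by (intro sum.cong) (auto simp: powr_powr)
  finally show ?thesis .
qed

section \<open>A projected quasi-subgradient step\<close>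

text \<open>
  For \<open>r\<close> below the claimed bound the point \<open>s + r *\<^sub>R g\<close> still has a value smaller than \<open>h z\<close>, so the
  defining inequality of the quasi-subdifferential applies to it and reads \<open>r \<le> g \<bullet> (z - s)\<close>.
\<close>
lemma quasi_subdiff_gap:
  fixes h :: "'a::real_inner \<Rightarrow> real"
  assumes g: "g \<in> quasi_subdiff h z" "norm g = 1"
    and hoelder: "\<And>y. h y - h s \<le> K * norm (y - s) powr p"
    and "K > 0" "p > 0" "h s < h z"
  shows "((h z - h s) / K) powr (1 / p) \<le> g \<bullet> (z - s)"
proof (rule dense_le_bounded)
  show "0 < ((h z - h s) / K) powr (1 / p)"
    using assms by simp
next
  fix r assume r: "0 < r" "r < ((h z - h s) / K) powr (1 / p)"
  then have "r powr p < (((h z - h s) / K) powr (1 / p)) powr p"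
    using \<open>p > 0\<close> by (intro powr_less_mono2) auto
  also have "\<dots> = (h z - h s) / K"
    using assms by (simp add: powr_powr)
  finally have "K * r powr p < h z - h s"
    using \<open>K > 0\<close> by (simp add: field_simps)
  moreover have "h (s + r *\<^sub>R g) - h s \<le> K * r powr p"
    using hoelder[of "s + r *\<^sub>R g"] g r by simp
  ultimately have "g \<bullet> (s + r *\<^sub>R g - z) \<le> 0"
    using g by (auto simp: quasi_subdiff_def)
  moreover have "g \<bullet> g = 1"
    using g by (simp add: dot_square_norm)
  ultimately show "r \<le> g \<bullet> (z - s)"
    by (simp add: inner_simps)
qed

lemma projected_step_dist:
  fixes X :: "'a::euclidean_space set"
  assumes X: "closed X" "convex X" and "s \<in> X" "norm g = 1" "v \<ge> 0" "r \<le> g \<bullet> (z - s)"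
  shows "(dist (closest_point X (z - v *\<^sub>R g)) s)\<^sup>2 \<le> (dist z s)\<^sup>2 - 2 * v * r + v\<^sup>2"
proof -
  have "dist (closest_point X (z - v *\<^sub>R g)) s \<le> dist (z - v *\<^sub>R g) s"
    using closest_point_lipschitz[of X "z - v *\<^sub>R g" s] assms closest_point_self[of s X] by auto
  then have "(dist (closest_point X (z - v *\<^sub>R g)) s)\<^sup>2 \<le> (dist (z - v *\<^sub>R g) s)\<^sup>2"
    by (simp add: power_mono)
  also have "\<dots> = (norm ((z - s) - v *\<^sub>R g))\<^sup>2"
    by (simp add: dist_norm algebra_simps)
  also have "\<dots> = (dist z s)\<^sup>2 - 2 * v * (g \<bullet> (z - s)) + v\<^sup>2 * (g \<bullet> g)"
    unfolding dist_norm power2_norm_eq_inner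
    by (simp add: inner_simps inner_commute algebra_simps power2_eq_square)
  also have "\<dots> \<le> (dist z s)\<^sup>2 - 2 * v * r + v\<^sup>2"
    using assms by (simp add: dot_square_norm mult_left_mono)
  finally show ?thesis .
qed

lemma projected_step_length:
  fixes X :: "'a::euclidean_space set"
  assumes "closed X" "convex X" "z \<in> X" "norm g = 1" "v \<ge> 0"
  shows "dist (closest_point X (z - v *\<^sub>R g)) z \<le> v"
  using closest_point_lipschitz[of X "z - v *\<^sub>R g" z] assms closest_point_self[of z X]
  by (auto simp: dist_norm)

section \<open>One pass through the components\<close>

text \<open>
  A pass can avoid the projection only by skipping every component, that is, only if each component
  takes its optimal value at the starting point.
\<close>
lemma incremental_pass_in_constraint_set:
  assumes "closed X" "X \<noteq> {}" and pass: "incremental_pass X m f v x x'"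
    and start: "x \<in> X \<or> (\<exists>i\<in>{1..m}. f i x \<noteq> min_value X (f i))"
  shows "x' \<in> X"
proof -
  obtain z where z0: "z 0 = x" and zm: "z m = x'"
    and z: "\<And>i. i \<in> {1..m} \<Longrightarrow>
           if f i (z (i - 1)) = min_value X (f i)
           then z i = z (i - 1)
           else \<exists>g \<in> quasi_subdiff (f i) (z (i - 1)) \<inter> sphere 0 1.
                  z i = closest_point X (z (i - 1) - v *\<^sub>R g)"
    using pass unfolding incremental_pass_def by blast
  have "z j \<in> X \<or> (z j = x \<and> (\<forall>i\<in>{1..j}. f i x = min_value X (f i)))" if "j \<le> m" for j
    using that
  proof (induction j)
    case 0
    then show ?case by (simp add: z0)
  next
    case (Suc j)
    then have IH: "z j \<in> X \<or> (z j = x \<and> (\<forall>i\<in>{1..j}. f i x = min_value X (f i)))"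
      by simp
    show ?case
    proof (cases "f (Suc j) (z j) = min_value X (f (Suc j))")
      case True
      then have "z (Suc j) = z j"
        using z[of "Suc j"] Suc.prems by simp
      then show ?thesis
        using IH True by (auto simp: le_Suc_eq)
    next
      case False
      then show ?thesis
        using z[of "Suc j"] Suc.prems closest_point_in_set[OF assms(1,2)] by auto
    qed
  qed
  from this[of m] zm start show ?thesis by auto
qed

text \<open>
  The error term \<open>m\<^sup>2 v\<^sup>2\<close> has two sources: \<open>m v\<^sup>2\<close> from the lengths of the \<open>m\<close> inner steps, and
  \<open>m (m - 1) v\<^sup>2\<close> from evaluating component \<open>i\<close> at a point up to \<open>(i - 1) v\<close> away from \<open>x\<close>.
\<close>
lemma incremental_pass_descent:
  fixes X :: "'a::euclidean_space set"
  assumes X: "closed X" "convex X"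
    and s: "\<And>i. i \<in> {1..m} \<Longrightarrow> s \<in> argmin_set X (f i)"
    and hoelder: "\<And>i a b. i \<in> {1..m} \<Longrightarrow> a \<in> X \<Longrightarrow> \<bar>f i b - f i a\<bar> \<le> K * norm (b - a) powr p"
    and "K > 0" "p > 0" "v \<ge> 0" "x \<in> X" "s \<in> X"
    and pass: "incremental_pass X m f v x x'"
  shows "(dist x' s)\<^sup>2 \<le> (dist x s)\<^sup>2
      - 2 * v * (K powr (- (1 / p)) * min 1 (real (2 * m) powr (1 - 1 / p))
                  * (objective m f x - objective m f s) powr (1 / p))
      + (real m)\<^sup>2 * v\<^sup>2"
proof -
  obtain z where z0: "z 0 = x" and zm: "z m = x'"
    and z: "\<And>i. i \<in> {1..m} \<Longrightarrow>
           if f i (z (i - 1)) = min_value X (f i)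
           then z i = z (i - 1)
           else \<exists>g \<in> quasi_subdiff (f i) (z (i - 1)) \<inter> sphere 0 1.
                  z i = closest_point X (z (i - 1) - v *\<^sub>R g)"
    using pass unfolding incremental_pass_def by blast
  have gap: "0 \<le> f i y - f i s" if "i \<in> {1..m}" "y \<in> X" for i y
    using s[OF that(1)] that(2) by (simp add: argmin_set_iff)
  define r where "r i = ((f i (z (i - 1)) - f i s) / K) powr (1 / p)" for i
  define d where "d i = real (i - 1) * v" for i
  have step: "z (Suc j) \<in> X \<and> dist (z (Suc j)) (z j) \<le> v
      \<and> (dist (z (Suc j)) s)\<^sup>2 \<le> (dist (z j) s)\<^sup>2 - 2 * v * r (Suc j) + v\<^sup>2"
    if j: "Suc j \<le> m" and "z j \<in> X" for j
  proof (cases "f (Suc j) (z j) = min_value X (f (Suc j))")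
    case True
    moreover have "f (Suc j) (z j) = f (Suc j) s"
      using True min_value_eq[OF s] j by simp
    ultimately show ?thesis
      using z[of "Suc j"] j \<open>v \<ge> 0\<close> \<open>z j \<in> X\<close> by (simp add: r_def)
  next
    case False
    then obtain g where g: "g \<in> quasi_subdiff (f (Suc j)) (z j)" "norm g = 1"
      and zj: "z (Suc j) = closest_point X (z j - v *\<^sub>R g)"
      using z[of "Suc j"] j by auto
    have "f (Suc j) s < f (Suc j) (z j)"
      using False gap[of "Suc j" "z j"] min_value_eq[OF s, of "Suc j"] j \<open>z j \<in> X\<close> by simp
    moreover have "f (Suc j) y - f (Suc j) s \<le> K * norm (y - s) powr p" for y
      using hoelder[of "Suc j" s y] j \<open>s \<in> X\<close> by simp
    ultimately have "r (Suc j) \<le> g \<bullet> (z j - s)"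
      using g quasi_subdiff_gap[of g "f (Suc j)" "z j" s K p] \<open>K > 0\<close> \<open>p > 0\<close>
      by (simp add: r_def)
    then show ?thesis
      unfolding zj
      using projected_step_dist[OF X \<open>s \<in> X\<close>] projected_step_length[OF X] g \<open>v \<ge> 0\<close> \<open>z j \<in> X\<close>
        closest_point_in_set[OF X(1)] by blast
  qed
  have inv: "z j \<in> X \<and> dist (z j) x \<le> real j * v
      \<and> (dist (z j) s)\<^sup>2 \<le> (dist x s)\<^sup>2 - 2 * v * (\<Sum>i = 1..j. r i) + real j * v\<^sup>2"
    if "j \<le> m" for j
    using that
  proof (induction j)
    case 0
    then show ?case using \<open>x \<in> X\<close> by (simp add: z0)
  next
    case (Suc j)
    then have "z j \<in> X" "dist (z j) x \<le> real j * v"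
      "(dist (z j) s)\<^sup>2 \<le> (dist x s)\<^sup>2 - 2 * v * (\<Sum>i = 1..j. r i) + real j * v\<^sup>2"
      by auto
    then show ?case
      using step[OF Suc.prems] dist_triangle[of "z (Suc j)" x "z j"]
      by (auto simp: algebra_simps)
  qed
  have term_bound: "f i x - f i s \<le> K * (r i powr p + d i powr p)" if i: "i \<in> {1..m}" for i
  proof -
    have zi: "z (i - 1) \<in> X" "dist (z (i - 1)) x \<le> d i"
      using inv[of "i - 1"] i by (auto simp: d_def)
    have "K * r i powr p = f i (z (i - 1)) - f i s"
      using gap[OF i zi(1)] \<open>K > 0\<close> \<open>p > 0\<close> by (simp add: r_def powr_powr)
    moreover have "f i x - f i (z (i - 1)) \<le> K * norm (x - z (i - 1)) powr p"
      using hoelder[OF i zi(1), of x] by simp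
    moreover have "K * norm (x - z (i - 1)) powr p \<le> K * d i powr p"
      using zi(2) \<open>K > 0\<close> \<open>p > 0\<close>
      by (intro mult_left_mono powr_mono2) (auto simp: dist_norm norm_minus_commute)
    ultimately show ?thesis
      by (simp add: algebra_simps)
  qed
  \<comment> \<open>The depths and the drifts form one family of \<open>2 * m\<close> numbers, to be compared at once.\<close>
  define A where "A = {1..m} <+> {1..m}"
  define a where "a = case_sum r d"
  define D where "D = objective m f x - objective m f s"
  have D_eq: "D = (\<Sum>i = 1..m. f i x - f i s)"
    by (simp add: D_def objective_def sum_subtractf)
  have "D \<ge> 0"
    unfolding D_eq using gap \<open>x \<in> X\<close> by (intro sum_nonneg) auto
  have "D \<le> (\<Sum>i = 1..m. K * (r i powr p + d i powr p))"
    unfolding D_eq using term_bound by (rule sum_mono)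
  also have "\<dots> = K * (\<Sum>j\<in>A. a j powr p)"
    by (simp add: A_def a_def sum.Plus sum_distrib_left sum.distrib comp_def distrib_left)
  finally have "D / K \<le> (\<Sum>j\<in>A. a j powr p)"
    using \<open>K > 0\<close> by (simp add: field_simps)
  then have "min 1 (real (card A) powr (1 - 1 / p)) * (D / K) powr (1 / p) \<le> (\<Sum>j\<in>A. a j)"
    using \<open>p > 0\<close> \<open>K > 0\<close> \<open>D \<ge> 0\<close> \<open>v \<ge> 0\<close>
    by (intro sum_ge_powr_inverse) (auto simp: A_def a_def r_def d_def)
  moreover have "card A = 2 * m"
    by (simp add: A_def card_Plus)
  moreover have "(\<Sum>j\<in>A. a j) = (\<Sum>i = 1..m. r i) + (\<Sum>i = 1..m. d i)"
    by (simp add: A_def a_def sum.Plus comp_def)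
  ultimately have "K powr (- (1 / p)) * min 1 (real (2 * m) powr (1 - 1 / p)) * D powr (1 / p)
      \<le> (\<Sum>i = 1..m. r i) + (\<Sum>i = 1..m. d i)"
    by (simp add: powr_divide powr_minus_divide mult_ac)
  moreover have "2 * (\<Sum>i = 1..j. d i) = ((real j)\<^sup>2 - real j) * v" for j
    by (induction j) (auto simp: d_def algebra_simps power2_eq_square)
  note this[of m]
  ultimately have "2 * (K powr (- (1 / p)) * min 1 (real (2 * m) powr (1 - 1 / p)) * D powr (1 / p))
      \<le> 2 * (\<Sum>i = 1..m. r i) + ((real m)\<^sup>2 - real m) * v"
    by linarith
  then have "v * (2 * (K powr (- (1 / p)) * min 1 (real (2 * m) powr (1 - 1 / p)) * D powr (1 / p)))
      \<le> v * (2 * (\<Sum>i = 1..m. r i) + ((real m)\<^sup>2 - real m) * v)"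
    using \<open>v \<ge> 0\<close> by (rule mult_left_mono)
  moreover have "(dist x' s)\<^sup>2 \<le> (dist x s)\<^sup>2 - 2 * v * (\<Sum>i = 1..m. r i) + real m * v\<^sup>2"
    using inv[of m] zm by simp
  ultimately show ?thesis
    unfolding D_def[symmetric] by (simp add: algebra_simps power2_eq_square)
qed

section \<open>Fejer monotone sequences\<close>

text \<open>
  A cluster point \<open>l\<close> exists by boundedness. Since it belongs to \<open>S\<close>, the distance to \<open>l\<close> is
  nonincreasing, and it is small along a subsequence, hence from some index on.
\<close>
lemma fejer_monotone_convergent:
  fixes y :: "nat \<Rightarrow> 'a::heine_borel"
  assumes "S \<noteq> {}"
    and fejer: "\<And>s k. s \<in> S \<Longrightarrow> dist (y (Suc k)) s \<le> dist (y k) s"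
    and cluster: "\<And>l \<phi>. strict_mono \<phi> \<Longrightarrow> (y \<circ> \<phi>) \<longlonglongrightarrow> l \<Longrightarrow> l \<in> S"
  shows "\<exists>s\<in>S. y \<longlonglongrightarrow> s"
proof -
  have dec: "decseq (\<lambda>k. dist (y k) s)" if "s \<in> S" for s
    using fejer[OF that] by (rule decseq_SucI)
  obtain s0 where s0: "s0 \<in> S" using assms(1) by blast
  have "bounded (range y)"
    unfolding bounded_any_center[of _ s0] using decseqD[OF dec[OF s0], of 0]
    by (auto simp: dist_commute)
  then obtain l \<phi> where \<phi>: "strict_mono \<phi>" and l: "(y \<circ> \<phi>) \<longlonglongrightarrow> l"
    using bounded_imp_convergent_subsequence by blast
  have "l \<in> S"
    using cluster[OF \<phi> l] .
  have "(\<lambda>k. dist (y k) l) \<longlonglongrightarrow> 0"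
  proof (rule metric_LIMSEQ_I)
    fix e :: real assume "e > 0"
    then obtain n where n: "dist (y (\<phi> n)) l < e"
      using metric_LIMSEQ_D[OF l] by (auto simp: comp_def)
    have "dist (y k) l < e" if "k \<ge> \<phi> n" for k
      using decseqD[OF dec[OF \<open>l \<in> S\<close>] that] n by simp
    then show "\<exists>N. \<forall>k\<ge>N. dist (dist (y k) l) 0 < e"
      by (auto simp: dist_real_def)
  qed
  then show ?thesis
    using \<open>l \<in> S\<close> tendsto_dist_iff by blast
qed

section \<open>Convergence under the dynamic stepsize rule\<close>

theorem theorem3p3:
  fixes X :: "(real ^ 'n) set"
    and m :: nat
    and f :: "nat \<Rightarrow> real ^ 'n \<Rightarrow> real"
    and p \<gamma>_lo \<gamma>_hi :: real
    and L \<gamma> v :: "nat \<Rightarrow> real"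
    and x :: "nat \<Rightarrow> real ^ 'n"
  assumes X: "X \<noteq> {}" "closed X" "convex X"
    and m: "m \<ge> 1"
    and f_cont: "\<forall>i\<in>{1..m}. continuous_on UNIV (f i)"
    and f_qc: "\<forall>i\<in>{1..m}. quasi_convex (f i)"
    and common_solution: "(\<Inter>i\<in>{1..m}. argmin_set X (f i)) \<noteq> {}"
    and p: "p > 0"
    and L: "\<forall>i\<in>{1..m}. L i > 0"
    and holder: "\<forall>i\<in>{1..m}. \<forall>a\<in>X. \<forall>b. \<bar>f i b - f i a\<bar> \<le> L i * norm (b - a) powr p"
    and generated: "generated_by_incremental_method X m f v x"
    and start: "x 0 \<in> X \<or> objective m f (x 0) > min_value X (objective m f)"
    and \<gamma>_lo: "0 < \<gamma>_lo"
    and \<gamma>: "\<forall>k. \<gamma>_lo \<le> \<gamma> k \<and> \<gamma> k \<le> \<gamma>_hi"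
    and \<gamma>_hi: "\<gamma>_hi < 2"
    and stepsize: "\<forall>k. v k = \<gamma> k * (step_const p m L / (real m)\<^sup>2)
                          * (objective m f (x k) - min_value X (objective m f)) powr (1 / p)"
  shows "\<exists>x_opt \<in> argmin_set X (objective m f). x \<longlonglongrightarrow> x_opt"
proof -
  define F where "F = objective m f"
  define S where "S = argmin_set X F"
  define K where "K = Max (L ` {1..m})"
  define C where "C = step_const p m L"
  define c where "c = \<gamma>_lo * (2 - \<gamma>_hi) * (C / real m)\<^sup>2"
  have S_eq: "S = (\<Inter>i\<in>{1..m}. argmin_set X (f i))"
    unfolding S_def F_def using common_solution m by (rule argmin_objective)
  have "S \<noteq> {}" using common_solution S_eq by simp
  have S_min: "s \<in> X" "F s = min_value X F" if "s \<in> S" for s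
    using that min_value_eq[of s X F] by (auto simp: S_def argmin_set_iff)
  have L_le: "L i \<le> K" if "i \<in> {1..m}" for i
    unfolding K_def using that by simp
  have "K > 0"
    using L_le[of 1] L m by force
  have "C > 0"
    unfolding C_def step_const_def K_def[symmetric] using \<open>K > 0\<close> m by simp
  then have "c > 0"
    unfolding c_def using \<gamma>_lo \<gamma>_hi m by simp
  have hoelder: "\<bar>f i b - f i a\<bar> \<le> K * norm (b - a) powr p" if "i \<in> {1..m}" "a \<in> X" for i a b
    using holder that mult_right_mono[OF L_le[OF that(1)] powr_ge_zero, of "norm (b - a)" p]
    by (meson order_trans)
  have F_cont: "continuous_on UNIV F"
    unfolding F_def objective_def[abs_def] using f_cont by (intro continuous_intros) auto
  have next_in_X: "x (Suc k) \<in> X" if "x k \<in> X \<or> F (x k) > min_value X F" for k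
  proof (cases "F (x k) > min_value X F")
    case True
    then have pass: "incremental_pass X m f (v k) (x k) (x (Suc k))"
      using generated by (simp add: generated_by_incremental_method_def F_def)
    obtain s where s: "s \<in> S" using \<open>S \<noteq> {}\<close> by blast
    have "\<exists>i\<in>{1..m}. f i (x k) \<noteq> min_value X (f i)"
    proof (rule ccontr)
      assume "\<not> ?thesis"
      then have "F (x k) = F s"
        using s min_value_eq[of s X] by (simp add: F_def objective_def S_eq)
      then show False using True S_min(2)[OF s] by simp
    qed
    then show ?thesis
      using incremental_pass_in_constraint_set[OF X(2,1) pass] by blast
  next
    case False
    then show ?thesis
      using that generated by (simp add: generated_by_incremental_method_def F_def)
  qed
  \<comment> \<open>The initial point may lie outside \<open>X\<close>, so the sequence is studied from its second term on.\<close>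
  define y where "y k = x (Suc k)" for k
  have yX: "y k \<in> X" for k
    by (induction k) (use start next_in_X in \<open>auto simp: y_def F_def\<close>)
  define e where "e k = (F (y k) - min_value X F) powr (1 / p)" for k
  have F_ge: "F (y k) \<ge> min_value X F" for k
    using S_min(2) \<open>S \<noteq> {}\<close> yX unfolding S_def by (force simp: argmin_set_iff)
  have descent: "(dist (y (Suc k)) s)\<^sup>2 \<le> (dist (y k) s)\<^sup>2 - c * (e k)\<^sup>2" if s: "s \<in> S" for s k
  proof (cases "F (y k) > min_value X F")
    case True
    \<comment> \<open>\<open>G * (C / m\<^sup>2) * e k\<close> is \<open>G\<close> times the minimizer of the quadratic bound in the stepsize.\<close>
    define G where "G = \<gamma> (Suc k)"
    have G: "\<gamma>_lo \<le> G" "G \<le> \<gamma>_hi" using \<gamma> by (auto simp: G_def)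
    have v_eq: "v (Suc k) = G * (C / (real m)\<^sup>2) * e k"
      using stepsize by (simp add: G_def C_def e_def y_def F_def)
    have "v (Suc k) \<ge> 0"
      unfolding v_eq using G \<gamma>_lo \<open>C > 0\<close> by (simp add: e_def)
    moreover have "incremental_pass X m f (v (Suc k)) (y k) (y (Suc k))"
      using generated True by (simp add: generated_by_incremental_method_def F_def y_def)
    ultimately have "(dist (y (Suc k)) s)\<^sup>2 \<le> (dist (y k) s)\<^sup>2
      - 2 * v (Suc k) * (C * (F (y k) - F s) powr (1 / p)) + (real m)\<^sup>2 * (v (Suc k))\<^sup>2"
      unfolding C_def step_const_def K_def[symmetric] F_def
      using s S_eq S_min(1)[OF s] \<open>K > 0\<close> p yX hoelder
      by (intro incremental_pass_descent[OF X(2,3)]) auto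
    also have "\<dots> = (dist (y k) s)\<^sup>2 - 2 * v (Suc k) * (C * e k) + (real m)\<^sup>2 * (v (Suc k))\<^sup>2"
      using S_min(2)[OF s] by (simp add: e_def)
    also have "\<dots> = (dist (y k) s)\<^sup>2 - G * (2 - G) * ((C / real m)\<^sup>2 * (e k)\<^sup>2)"
      unfolding v_eq using m by (simp add: field_simps power2_eq_square)
    also have "\<dots> \<le> (dist (y k) s)\<^sup>2 - \<gamma>_lo * (2 - \<gamma>_hi) * ((C / real m)\<^sup>2 * (e k)\<^sup>2)"
      using G \<gamma>_lo \<gamma>_hi by (intro diff_left_mono mult_right_mono mult_mono) auto
    finally show ?thesis by (simp add: c_def mult_ac)
  next
    case False
    then have "e k = 0" using F_ge[of k] by (simp add: e_def)
    moreover have "y (Suc k) = y k"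
      using generated False by (simp add: generated_by_incremental_method_def F_def y_def)
    ultimately show ?thesis by simp
  qed
  have gap_tendsto: "(\<lambda>k. F (y k)) \<longlonglongrightarrow> min_value X F"
  proof -
    obtain s where s: "s \<in> S" using \<open>S \<noteq> {}\<close> by blast
    have "(\<Sum>k<n. c * (e k)\<^sup>2) \<le> (dist (y 0) s)\<^sup>2 - (dist (y n) s)\<^sup>2" for n
    proof (induction n)
      case (Suc n)
      then show ?case using descent[OF s, of n] by simp
    qed simp
    then have "(\<Sum>k<n. c * (e k)\<^sup>2) \<le> (dist (y 0) s)\<^sup>2" for n
      by (smt (verit) zero_le_power2)
    then have "summable (\<lambda>k. c * (e k)\<^sup>2)"
      using \<open>c > 0\<close> by (intro summableI_nonneg_bounded) auto
    then have "(\<lambda>k. (c * (e k)\<^sup>2) / c) \<longlonglongrightarrow> 0 / c"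
      using \<open>c > 0\<close> by (intro tendsto_divide summable_LIMSEQ_zero tendsto_const) auto
    then have "(\<lambda>k. sqrt ((e k)\<^sup>2)) \<longlonglongrightarrow> sqrt 0"
      using \<open>c > 0\<close> by (intro tendsto_real_sqrt) simp
    then have "e \<longlonglongrightarrow> 0"
      by (simp add: e_def[abs_def])
    then have "(\<lambda>k. e k powr p) \<longlonglongrightarrow> 0 powr p"
      using tendsto_powr2[OF _ tendsto_const, of e 0 sequentially p] p by (simp add: e_def)
    then have "(\<lambda>k. F (y k) - min_value X F) \<longlonglongrightarrow> 0"
      using p F_ge by (simp add: e_def powr_powr)
    then show ?thesis
      by (simp add: LIM_zero_iff)
  qed
  have "\<exists>s\<in>S. y \<longlonglongrightarrow> s"
  proof (rule fejer_monotone_convergent)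
    show "S \<noteq> {}" by fact
  next
    fix s k assume "s \<in> S"
    have "0 \<le> c * (e k)\<^sup>2"
      using \<open>c > 0\<close> by simp
    then have "(dist (y (Suc k)) s)\<^sup>2 \<le> (dist (y k) s)\<^sup>2"
      using descent[OF \<open>s \<in> S\<close>, of k] by linarith
    then show "dist (y (Suc k)) s \<le> dist (y k) s"
      by (rule power2_le_imp_le) simp
  next
    fix l \<phi> assume \<phi>: "strict_mono (\<phi> :: nat \<Rightarrow> nat)" and l: "(y \<circ> \<phi>) \<longlonglongrightarrow> l"
    have "l \<in> X"
      using closed_sequentially[OF X(2) _ l] yX by simp
    have "(\<lambda>k. F ((y \<circ> \<phi>) k)) \<longlonglongrightarrow> F l"
      using continuous_on_tendsto_compose[OF F_cont l] by simp
    moreover have "(\<lambda>k. F ((y \<circ> \<phi>) k)) \<longlonglongrightarrow> min_value X F"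
      using LIMSEQ_subseq_LIMSEQ[OF gap_tendsto \<phi>] by (simp add: comp_def)
    ultimately have "F l = min_value X F"
      by (rule LIMSEQ_unique)
    then show "l \<in> S"
      using \<open>l \<in> X\<close> \<open>S \<noteq> {}\<close> S_min(2) by (fastforce simp: S_def argmin_set_iff)
  qed
  then obtain s where "s \<in> S" "y \<longlonglongrightarrow> s" by blast
  then show ?thesis
    unfolding y_def S_def F_def by (auto intro: LIMSEQ_imp_Suc)
qed

end
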